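(* Let $K$ be a small category and $G$ a group acting on $K$. The action satisfies Condition (R) if and only if the canonical surjection $\lambda:\Delta(K)/G\to\Delta(K/G)$ is injective on $1$-skeleta.
   Context: For a small category $K$, $\mathcal O(K)$ is its set of objects and $\mathcal M(K)$ its set of morphisms; a morphism $m$ from $a$ to $b$ has $\partial^\bullet m=a$ (source) and $\partial_\bullet m=b$ (target). Composition is written in diagrammatic order: $x\circ y$ is defined when $\partial_\bullet x=\partial^\bullet y$. A group $G$ (viewed as a category with one object) acts on $K$ if there is a functor $\mathcal A_K:G\to\mathbf{Cat}$ ($\mathbf{Cat}$ = category of small categories) sending the unique object to $K$; thus each $g\in G$ acts as an automorphism of $K$. $Gx$ denotes the orbit of a morphism $x$. The quotient $K/G$ is the colimit of $\mathcal A_K$ in $\mathbf{Cat}$; $[m]$ denotes the image in $K/G$ of $m\in\mathcal M(K)$. $\Delta(K)$ is the nerve of $K$, a simplicial set whose $t$-simplices are the chains $(n_1,\dots,n_t)$ of morphisms with $\partial_\bullet n_{i-1}=\partial^\bullet n_i$ (objects for $t=0$). $G$ acts on $\Delta(K)$, and $\Delta(K)/G$ is the colimit of this action in simplicial sets, whose $t$-simplices are the orbits $G(n_1,\dots,n_t)$. The canonical map is $\lambda(G(n_1,\dots,n_t))=([n_1],\dots,[n_t])$, $\lambda(Ga)=[a]$ for objects $a$. Condition (R): whenever $x,y_a,y_b\in\mathcal M(K)$ satisfy $\partial_\bullet x=\partial^\bullet y_a=\partial^\bullet y_b$ and $Gy_a=Gy_b$, then $G(x\circ y_a)=G(x\circ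 y_b)$. *)

theory Defs
  imports "HOL-Algebra.Group_Action"
begin

section \<open>Small categories and functors\<close>

text \<open>Composition is in diagrammatic order: \<open>Comp C x y\<close> is ``first \<open>x\<close>, then \<open>y\<close>''
  and is meaningful when \<open>Tgt C x = Src C y\<close>.\<close>

record ('o, 'm) cat =
  Obj :: "'o set"
  Mor :: "'m set"
  Src :: "'m \<Rightarrow> 'o"
  Tgt :: "'m \<Rightarrow> 'o"
  Ident :: "'o \<Rightarrow> 'm"
  Comp :: "'m \<Rightarrow> 'm \<Rightarrow> 'm"

locale category =
  fixes C :: "('o, 'm) cat"
  assumes src_obj: "m \<in> Mor C \<Longrightarrow> Src C m \<in> Obj C"
    and tgt_obj: "m \<in> Mor C \<Longrightarrow> Tgt C m \<in> Obj C"
    and ident_mor: "a \<in> Obj C \<Longrightarrow> Ident C a \<in> Mor C"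
    and src_ident: "a \<in> Obj C \<Longrightarrow> Src C (Ident C a) = a"
    and tgt_ident: "a \<in> Obj C \<Longrightarrow> Tgt C (Ident C a) = a"
    and comp_mor: "\<lbrakk>x \<in> Mor C; y \<in> Mor C; Tgt C x = Src C y\<rbrakk> \<Longrightarrow> Comp C x y \<in> Mor C"
    and src_comp: "\<lbrakk>x \<in> Mor C; y \<in> Mor C; Tgt C x = Src C y\<rbrakk> \<Longrightarrow> Src C (Comp C x y) = Src C x"
    and tgt_comp: "\<lbrakk>x \<in> Mor C; y \<in> Mor C; Tgt C x = Src C y\<rbrakk> \<Longrightarrow> Tgt C (Comp C x y) = Tgt C y"
    and ident_left: "x \<in> Mor C \<Longrightarrow> Comp C (Ident C (Src C x)) x = x"
    and ident_right: "x \<in> Mor C \<Longrightarrow> Comp C x (Ident C (Tgt C x)) = x"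
    and comp_assoc: "\<lbrakk>x \<in> Mor C; y \<in> Mor C; z \<in> Mor C; Tgt C x = Src C y; Tgt C y = Src C z\<rbrakk>
      \<Longrightarrow> Comp C (Comp C x y) z = Comp C x (Comp C y z)"

definition is_functor ::
  "('o, 'm) cat \<Rightarrow> ('p, 'n) cat \<Rightarrow> ('o \<Rightarrow> 'p) \<Rightarrow> ('m \<Rightarrow> 'n) \<Rightarrow> bool" where
  "is_functor C D fo fm \<longleftrightarrow>
     (\<forall>a\<in>Obj C. fo a \<in> Obj D \<and> fm (Ident C a) = Ident D (fo a)) \<and>
     (\<forall>m\<in>Mor C. fm m \<in> Mor D \<and> Src D (fm m) = fo (Src C m) \<and> Tgt D (fm m) = fo (Tgt C m)) \<and>
     (\<forall>x\<in>Mor C. \<forall>y\<in>Mor C. Tgt C x = Src C y \<longrightarrow> fm (Comp C x y) = Comp D (fm x) (fm y))"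


section \<open>Group actions on categories and quotients\<close>

text \<open>A homomorphism from \<open>G\<close> to the automorphisms of \<open>K\<close>, that is, a left action.  By the
  convention of \<open>group_action\<close>, the maps \<open>\<phi>o g\<close> and \<open>\<phi>m g\<close> are \<open>undefined\<close> outside of the
  objects and morphisms of \<open>K\<close>.\<close>

locale category_action =
  category K + obj: group_action G "Obj K" \<phi>o + mor: group_action G "Mor K" \<phi>m
  for G :: "('g, 'x) monoid_scheme" (structure) and K :: "('o, 'm) cat"
    and \<phi>o :: "'g \<Rightarrow> 'o \<Rightarrow> 'o" and \<phi>m :: "'g \<Rightarrow> 'm \<Rightarrow> 'm" +
  assumes action_functor: "g \<in> carrier G \<Longrightarrow> is_functor K K (\<phi>o g) (\<phi>m g)"

text \<open>Cocones from the diagram \<open>G \<rightarrow> Cat\<close> given by the action to the category \<open>T\<close>.\<close>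

definition is_cocone ::
  "('g, 'x) monoid_scheme \<Rightarrow> ('o, 'm) cat \<Rightarrow> ('g \<Rightarrow> 'o \<Rightarrow> 'o) \<Rightarrow> ('g \<Rightarrow> 'm \<Rightarrow> 'm)
   \<Rightarrow> ('p, 'n) cat \<Rightarrow> ('o \<Rightarrow> 'p) \<Rightarrow> ('m \<Rightarrow> 'n) \<Rightarrow> bool" where
  "is_cocone G K \<phi>o \<phi>m T fo fm \<longleftrightarrow>
     category T \<and> is_functor K T fo fm \<and>
     (\<forall>g\<in>carrier G. (\<forall>a\<in>Obj K. fo (\<phi>o g a) = fo a) \<and> (\<forall>m\<in>Mor K. fm (\<phi>m g m) = fm m))"

definition factors_uniquely ::
  "('o, 'm) cat \<Rightarrow> ('p, 'n) cat \<Rightarrow> ('o \<Rightarrow> 'p) \<Rightarrow> ('m \<Rightarrow> 'n)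
   \<Rightarrow> ('q, 'r) cat \<Rightarrow> ('o \<Rightarrow> 'q) \<Rightarrow> ('m \<Rightarrow> 'r) \<Rightarrow> bool" where
  "factors_uniquely K Q qo qm T fo fm \<longleftrightarrow>
     (\<exists>uo um. is_functor Q T uo um \<and>
        (\<forall>a\<in>Obj K. uo (qo a) = fo a) \<and> (\<forall>m\<in>Mor K. um (qm m) = fm m) \<and>
        (\<forall>vo vm. is_functor Q T vo vm \<and>
           (\<forall>a\<in>Obj K. vo (qo a) = fo a) \<and> (\<forall>m\<in>Mor K. vm (qm m) = fm m) \<longrightarrow>
           (\<forall>b\<in>Obj Q. vo b = uo b) \<and> (\<forall>n\<in>Mor Q. vm n = um n)))"

text \<open>\<open>Q\<close> with the functor \<open>(qo, qm) : K \<rightarrow> Q\<close> is a colimit of the action.  The universal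
  property is quantified over the categories carried by the types of \<open>K\<close>.  This is no
  restriction: below, a colimit carried by these types always exists (\<open>quotient_exists\<close>), and
  every such colimit has the universal property with respect to the categories carried by
  arbitrary types (\<open>quotient_universal\<close>).\<close>

definition is_quotient ::
  "('g, 'x) monoid_scheme \<Rightarrow> ('o, 'm) cat \<Rightarrow> ('g \<Rightarrow> 'o \<Rightarrow> 'o) \<Rightarrow> ('g \<Rightarrow> 'm \<Rightarrow> 'm)
   \<Rightarrow> ('o, 'm) cat \<Rightarrow> ('o \<Rightarrow> 'o) \<Rightarrow> ('m \<Rightarrow> 'm) \<Rightarrow> bool" where
  "is_quotient G K \<phi>o \<phi>m Q qo qm \<longleftrightarrow>
     is_cocone G K \<phi>o \<phi>m Q qo qm \<and>
     (\<forall>(T :: ('o, 'm) cat) fo fm. is_cocone G K \<phi>o \<phi>m T fo fm \<longrightarrow>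
        factors_uniquely K Q qo qm T fo fm)"

definition condition_R ::
  "('g, 'x) monoid_scheme \<Rightarrow> ('o, 'm) cat \<Rightarrow> ('g \<Rightarrow> 'm \<Rightarrow> 'm) \<Rightarrow> bool" where
  "condition_R G K \<phi>m \<longleftrightarrow>
     (\<forall>x\<in>Mor K. \<forall>ya\<in>Mor K. \<forall>yb\<in>Mor K.
        Tgt K x = Src K ya \<and> Tgt K x = Src K yb \<and> orbit G \<phi>m ya = orbit G \<phi>m yb \<longrightarrow>
        orbit G \<phi>m (Comp K x ya) = orbit G \<phi>m (Comp K x yb))"


section \<open>Simplicial sets, nerves and their quotients\<close>

text \<open>\<open>Face X k i\<close> and \<open>Degen X k i\<close> are the \<open>i\<close>-th face and degeneracy operators on
  \<open>k\<close>-simplices.\<close>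

record 's sset =
  Simp :: "nat \<Rightarrow> 's set"
  Face :: "nat \<Rightarrow> nat \<Rightarrow> 's \<Rightarrow> 's"
  Degen :: "nat \<Rightarrow> nat \<Rightarrow> 's \<Rightarrow> 's"

locale simplicial_set =
  fixes X :: "'s sset"
  assumes face_simp: "\<lbrakk>x \<in> Simp X (Suc k); i \<le> Suc k\<rbrakk> \<Longrightarrow> Face X (Suc k) i x \<in> Simp X k"
    and degen_simp: "\<lbrakk>x \<in> Simp X k; i \<le> k\<rbrakk> \<Longrightarrow> Degen X k i x \<in> Simp X (Suc k)"
    and face_face: "\<lbrakk>x \<in> Simp X (Suc (Suc k)); i < j; j \<le> Suc (Suc k)\<rbrakk> \<Longrightarrow>
      Face X (Suc k) i (Face X (Suc (Suc k)) j x) =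
      Face X (Suc k) (j - 1) (Face X (Suc (Suc k)) i x)"
    and degen_degen: "\<lbrakk>x \<in> Simp X k; i \<le> j; j \<le> k\<rbrakk> \<Longrightarrow>
      Degen X (Suc k) i (Degen X k j x) = Degen X (Suc k) (Suc j) (Degen X k i x)"
    and face_degen_less: "\<lbrakk>x \<in> Simp X (Suc k); i < j; j \<le> Suc k\<rbrakk> \<Longrightarrow>
      Face X (Suc (Suc k)) i (Degen X (Suc k) j x) = Degen X k (j - 1) (Face X (Suc k) i x)"
    and face_degen_same: "\<lbrakk>x \<in> Simp X k; j \<le> k\<rbrakk> \<Longrightarrow> Face X (Suc k) j (Degen X k j x) = x"
    and face_degen_Suc: "\<lbrakk>x \<in> Simp X k; j \<le> k\<rbrakk> \<Longrightarrow> Face X (Suc k) (Suc j) (Degen X k j x) = x"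
    and face_degen_greater: "\<lbrakk>x \<in> Simp X (Suc k); Suc j < i; i \<le> Suc (Suc k)\<rbrakk> \<Longrightarrow>
      Face X (Suc (Suc k)) i (Degen X (Suc k) j x) = Degen X k j (Face X (Suc k) (i - 1) x)"

text \<open>The \<open>n\<close>-skeleton: the simplicial subset generated by the simplices of dimension at
  most \<open>n\<close>, given levelwise.\<close>

inductive_set skeleton_rel :: "nat \<Rightarrow> 's sset \<Rightarrow> (nat \<times> 's) set" for n X where
  base: "\<lbrakk>k \<le> n; x \<in> Simp X k\<rbrakk> \<Longrightarrow> (k, x) \<in> skeleton_rel n X"
| face: "\<lbrakk>(Suc k, x) \<in> skeleton_rel n X; i \<le> Suc k\<rbrakk> \<Longrightarrow> (k, Face X (Suc k) i x) \<in> skeleton_rel n X"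
| degen: "\<lbrakk>(k, x) \<in> skeleton_rel n X; i \<le> k\<rbrakk> \<Longrightarrow> (Suc k, Degen X k i x) \<in> skeleton_rel n X"

definition skeleton :: "nat \<Rightarrow> 's sset \<Rightarrow> nat \<Rightarrow> 's set" where
  "skeleton n X k = {x. (k, x) \<in> skeleton_rel n X}"

text \<open>Simplices of the nerve: objects in dimension \<open>0\<close>, and for \<open>t > 0\<close> the lists
  \<open>[n\<^sub>1, \<dots>, n\<^sub>t]\<close> of consecutive morphisms; the empty list is not used.\<close>

datatype ('o, 'm) chain = Vertex 'o | Chain "'m list"

definition nerve_simplices :: "('o, 'm) cat \<Rightarrow> nat \<Rightarrow> ('o, 'm) chain set" where
  "nerve_simplices C t =
     (if t = 0 then Vertex ` Obj C
      else Chain ` {ns. length ns = t \<and> set ns \<subseteq> Mor C \<and>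
        (\<forall>i. Suc i < t \<longrightarrow> Tgt C (ns ! i) = Src C (ns ! Suc i))})"

fun nerve_face :: "('o, 'm) cat \<Rightarrow> nat \<Rightarrow> nat \<Rightarrow> ('o, 'm) chain \<Rightarrow> ('o, 'm) chain" where
  "nerve_face C t i (Vertex a) = Vertex a"  (* junk: vertices have no faces *)
| "nerve_face C t i (Chain ns) =
     (if t = 1 then Vertex (if i = 0 then Tgt C (ns ! 0) else Src C (ns ! 0))
      else if i = 0 then Chain (tl ns)
      else if i = t then Chain (butlast ns)
      else Chain (take (i - 1) ns @ Comp C (ns ! (i - 1)) (ns ! i) # drop (Suc i) ns))"

fun nerve_degen :: "('o, 'm) cat \<Rightarrow> nat \<Rightarrow> nat \<Rightarrow> ('o, 'm) chain \<Rightarrow> ('o, 'm) chain" where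
  "nerve_degen C t i (Vertex a) = Chain [Ident C a]"
| "nerve_degen C t i (Chain ns) =
     Chain (take i ns @
       Ident C (if i < t then Src C (ns ! i) else Tgt C (ns ! (t - 1))) # drop i ns)"

definition nerve :: "('o, 'm) cat \<Rightarrow> ('o, 'm) chain sset" where
  "nerve C = \<lparr>Simp = nerve_simplices C, Face = nerve_face C, Degen = nerve_degen C\<rparr>"

text \<open>The simplicial map induced on nerves by a functor; in particular
  \<open>\<lambda>g. nerve_map (\<phi>o g) (\<phi>m g)\<close> is the induced action on \<open>nerve K\<close>.\<close>

fun nerve_map :: "('o \<Rightarrow> 'p) \<Rightarrow> ('m \<Rightarrow> 'n) \<Rightarrow> ('o, 'm) chain \<Rightarrow> ('p, 'n) chain" where
  "nerve_map fo fm (Vertex a) = Vertex (fo a)"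
| "nerve_map fo fm (Chain ns) = Chain (map fm ns)"

text \<open>Colimits of simplicial sets are computed levelwise, so the simplices of the quotient by a
  group action are the orbits; the operators act on an orbit elementwise.\<close>

definition sset_quotient ::
  "('g, 'x) monoid_scheme \<Rightarrow> ('g \<Rightarrow> 's \<Rightarrow> 's) \<Rightarrow> 's sset \<Rightarrow> 's set sset" where
  "sset_quotient G \<psi> X =
     \<lparr>Simp = (\<lambda>k. orbits G (Simp X k) \<psi>),
      Face = (\<lambda>k i S. Face X k i ` S),
      Degen = (\<lambda>k i S. Degen X k i ` S)\<rparr>"

definition nerve_quotient ::
  "('g, 'x) monoid_scheme \<Rightarrow> ('o, 'm) cat \<Rightarrow> ('g \<Rightarrow> 'o \<Rightarrow> 'o) \<Rightarrow> ('g \<Rightarrow> 'm \<Rightarrow> 'm)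
   \<Rightarrow> ('o, 'm) chain set sset" where
  "nerve_quotient G K \<phi>o \<phi>m = sset_quotient G (\<lambda>g. nerve_map (\<phi>o g) (\<phi>m g)) (nerve K)"

text \<open>The map \<open>\<lambda>\<close> sends the orbit of a simplex \<open>\<sigma>\<close> to the image of \<open>\<sigma>\<close> in the nerve of the
  quotient category; see \<open>canonical_map_orbit\<close>, and
  \<open>canonical_map_surjective\<close> for its surjectivity.\<close>

definition canonical_map ::
  "('o \<Rightarrow> 'p) \<Rightarrow> ('m \<Rightarrow> 'n) \<Rightarrow> ('o, 'm) chain set \<Rightarrow> ('p, 'n) chain" where
  "canonical_map qo qm S = the_elem (nerve_map qo qm ` S)"

section \<open>Existence and universality of the quotient\<close>

lemma (in group_action) orbit_eqI:
  assumes "x \<in> E" "g \<in> carrier G"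
  shows "orbit G \<phi> (\<phi> g x) = orbit G \<phi> x"
proof -
  have y: "\<phi> g x \<in> E" "\<phi> g x \<in> orbit G \<phi> x"
    using assms element_image by (auto simp: orbit_def)
  have E: "z \<in> E" if "w \<in> E" "z \<in> orbit G \<phi> w" for z w
    using that element_image by (auto simp: orbit_def)
  have x: "x \<in> orbit G \<phi> (\<phi> g x)"
    using orbit_sym[OF assms(1) y] .
  show ?thesis
  proof (intro equalityI subsetI)
    fix z assume z: "z \<in> orbit G \<phi> (\<phi> g x)"
    show "z \<in> orbit G \<phi> x" by (rule orbit_trans[OF assms(1) y(1) E[OF y(1) z] y(2) z])
  next
    fix z assume z: "z \<in> orbit G \<phi> x"
    show "z \<in> orbit G \<phi> (\<phi> g x)" by (rule orbit_trans[OF y(1) assms(1) E[OF assms(1) z] x z])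
  qed
qed

context category_action
begin

lemma act_obj: "g \<in> carrier G \<Longrightarrow> a \<in> Obj K \<Longrightarrow> \<phi>o g a \<in> Obj K"
  using action_functor unfolding is_functor_def by blast

lemma act_mor:
  assumes "g \<in> carrier G" "m \<in> Mor K"
  shows "\<phi>m g m \<in> Mor K" "Src K (\<phi>m g m) = \<phi>o g (Src K m)" "Tgt K (\<phi>m g m) = \<phi>o g (Tgt K m)"
  using action_functor[OF assms(1)] assms(2) unfolding is_functor_def by blast+

lemma act_ident: "g \<in> carrier G \<Longrightarrow> a \<in> Obj K \<Longrightarrow> \<phi>m g (Ident K a) = Ident K (\<phi>o g a)"
  using action_functor unfolding is_functor_def by blast

text \<open>The quotient is realised inside the types of \<open>K\<close> by choosing representatives: of the orbits
  for objects, and of the classes of the smallest congruence containing the orbit relation for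
  morphisms.  Every morphism of the quotient is represented by a morphism of \<open>K\<close>, since a
  morphism whose source is in the orbit of the target of another one can be moved to become
  composable with it.\<close>

inductive qrel :: "'m \<Rightarrow> 'm \<Rightarrow> bool" where
  qrefl: "m \<in> Mor K \<Longrightarrow> qrel m m"
| qact: "m \<in> Mor K \<Longrightarrow> g \<in> carrier G \<Longrightarrow> qrel (\<phi>m g m) m"
| qsym: "qrel m n \<Longrightarrow> qrel n m"
| qtrans: "qrel l m \<Longrightarrow> qrel m n \<Longrightarrow> qrel l n"
| qcomp: "qrel x x' \<Longrightarrow> qrel y y' \<Longrightarrow> Tgt K x = Src K y \<Longrightarrow> Tgt K x' = Src K y' \<Longrightarrow>
    qrel (Comp K x y) (Comp K x' y')"

definition orep :: "'o \<Rightarrow> 'o" where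
  "orep a = (SOME b. b \<in> orbit G \<phi>o a)"

definition mrep :: "'m \<Rightarrow> 'm" where
  "mrep m = (SOME n. qrel m n)"

definition quot_cat :: "('o, 'm) cat" where
  "quot_cat = \<lparr>Obj = orep ` Obj K, Mor = mrep ` Mor K,
     Src = (\<lambda>m. orep (Src K m)), Tgt = (\<lambda>m. orep (Tgt K m)), Ident = (\<lambda>a. mrep (Ident K a)),
     Comp = (\<lambda>x y. mrep (SOME z. \<exists>x' y'. qrel x x' \<and> qrel y y' \<and> Tgt K x' = Src K y' \<and>
       z = Comp K x' y'))\<rparr>"

lemma orep_act: "a \<in> Obj K \<Longrightarrow> g \<in> carrier G \<Longrightarrow> orep (\<phi>o g a) = orep a"
  by (simp add: orep_def obj.orbit_eqI)

lemma orep_cases: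
  assumes "a \<in> Obj K"
  obtains g where "g \<in> carrier G" "orep a = \<phi>o g a"
proof -
  have "orep a \<in> orbit G \<phi>o a"
    unfolding orep_def by (rule someI[of _ a]) (rule obj.orbit_refl[OF assms])
  then show thesis using that by (auto simp: orbit_def)
qed

lemma orep_obj: "a \<in> Obj K \<Longrightarrow> orep a \<in> Obj K"
  by (metis orep_cases act_obj)

lemma orep_orep: "a \<in> Obj K \<Longrightarrow> orep (orep a) = orep a"
  by (metis orep_cases orep_act)

lemma orep_eqD:
  assumes "a \<in> Obj K" "b \<in> Obj K" "orep a = orep b"
  obtains g where "g \<in> carrier G" "\<phi>o g b = a"
proof -
  interpret group G using obj.group_hom group_hom.axioms(1) by auto
  obtain g where g: "g \<in> carrier G" "orep a = \<phi>o g a" using orep_cases[OF assms(1)] .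
  obtain h where h: "h \<in> carrier G" "orep b = \<phi>o h b" using orep_cases[OF assms(2)] .
  have gh: "g \<in> carrier G" "h \<in> carrier G" "\<phi>o g a = \<phi>o h b" using g h assms(3) by auto
  have "\<phi>o (inv g) (\<phi>o h b) = a"
    using obj.orbit_sym_aux[OF gh(1) assms(1) gh(3)] .
  then have "\<phi>o (inv g \<otimes> h) b = a"
    by (simp add: obj.composition_rule[OF assms(2) inv_closed[OF gh(1)] gh(2)])
  then show thesis by (rule that[OF m_closed[OF inv_closed[OF gh(1)] gh(2)]])
qed

lemma qrel_mor: "qrel m n \<Longrightarrow> m \<in> Mor K \<and> n \<in> Mor K \<and>
    orep (Src K m) = orep (Src K n) \<and> orep (Tgt K m) = orep (Tgt K n)"
  by (induction rule: qrel.induct)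
    (auto simp: act_mor orep_act src_obj tgt_obj comp_mor src_comp tgt_comp)

lemma mrep_qrel: "m \<in> Mor K \<Longrightarrow> qrel m (mrep m)"
  unfolding mrep_def by (rule someI[of _ m]) (rule qrefl)

lemma mrep_eq: "qrel m n \<Longrightarrow> mrep m = mrep n"
proof -
  assume "qrel m n"
  then have "qrel m = qrel n" by (auto intro!: ext intro: qsym qtrans)
  then show ?thesis by (simp add: mrep_def)
qed

lemma mrep_eqD: "m \<in> Mor K \<Longrightarrow> n \<in> Mor K \<Longrightarrow> mrep m = mrep n \<Longrightarrow> qrel m n"
  by (metis mrep_qrel qsym qtrans)

lemma mrep_mor:
  assumes "m \<in> Mor K"
  shows "mrep m \<in> Mor K" "orep (Src K (mrep m)) = orep (Src K m)"
    "orep (Tgt K (mrep m)) = orep (Tgt K m)"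
  using qrel_mor[OF mrep_qrel[OF assms]] by auto

lemma mrep_act: "m \<in> Mor K \<Longrightarrow> g \<in> carrier G \<Longrightarrow> mrep (\<phi>m g m) = mrep m"
  by (rule mrep_eq) (rule qact)

lemma quot_comp:
  assumes "x \<in> Mor K" "y \<in> Mor K" "Tgt K x = Src K y"
  shows "Comp quot_cat (mrep x) (mrep y) = mrep (Comp K x y)"
proof -
  let ?P = "\<lambda>z. \<exists>x' y'. qrel (mrep x) x' \<and> qrel (mrep y) y' \<and> Tgt K x' = Src K y' \<and>
       z = Comp K x' y'"
  have "?P (Comp K x y)"
    using assms mrep_qrel qsym by blast
  then have "?P (SOME z. ?P z)" by (rule someI)
  then obtain x' y' where z: "qrel (mrep x) x'" "qrel (mrep y) y'" "Tgt K x' = Src K y'"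
    "(SOME z. ?P z) = Comp K x' y'" by blast
  have "qrel (Comp K x y) (SOME z. ?P z)"
    unfolding z(4)
    by (rule qcomp[OF qtrans[OF mrep_qrel z(1)] qtrans[OF mrep_qrel z(2)] assms(3) z(3)]) fact+
  then show ?thesis by (simp add: quot_cat_def mrep_eq)
qed

lemma lift_left:
  assumes "x \<in> Mor K" "y \<in> Mor K" "orep (Tgt K x) = orep (Src K y)"
  obtains y' where "y' \<in> Mor K" "mrep y' = mrep y" "Tgt K x = Src K y'"
    "\<exists>g\<in>carrier G. y' = \<phi>m g y"
proof -
  obtain g where "g \<in> carrier G" "\<phi>o g (Src K y) = Tgt K x"
    using orep_eqD assms src_obj tgt_obj by metis
  then show thesis using that[of "\<phi>m g y"] assms act_mor mrep_act by auto
qed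

lemma quot_simps:
  "Obj quot_cat = orep ` Obj K" "Mor quot_cat = mrep ` Mor K"
  "m \<in> Mor K \<Longrightarrow> Src quot_cat (mrep m) = orep (Src K m)"
  "m \<in> Mor K \<Longrightarrow> Tgt quot_cat (mrep m) = orep (Tgt K m)"
  "a \<in> Obj K \<Longrightarrow> Ident quot_cat (orep a) = mrep (Ident K a)"
proof -
  assume a: "a \<in> Obj K"
  then obtain g where "g \<in> carrier G" "orep a = \<phi>o g a" using orep_cases by blast
  then show "Ident quot_cat (orep a) = mrep (Ident K a)"
    using a by (simp add: quot_cat_def act_ident[symmetric] mrep_act ident_mor)
qed (auto simp: quot_cat_def mrep_mor)

lemma category_quot_cat: "category quot_cat"
proof
  fix x y
  assume "x \<in> Mor quot_cat" "y \<in> Mor quot_cat" and xy: "Tgt quot_cat x = Src quot_cat y"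
  then obtain x' y' where x: "x' \<in> Mor K" "x = mrep x'" and y: "y' \<in> Mor K" "y = mrep y'"
    by (auto simp: quot_simps)
  obtain y'' where y'': "y'' \<in> Mor K" "mrep y'' = y" "Tgt K x' = Src K y''"
    using lift_left[of x' y'] x y xy by (auto simp: quot_simps)
  note c = quot_comp[OF x(1) y''(1,3)]
  have s: "Comp K x' y'' \<in> Mor K" "Src K (Comp K x' y'') = Src K x'" "Tgt K (Comp K x' y'') = Tgt K y''"
    using x y'' by (auto simp: comp_mor src_comp tgt_comp)
  show "Comp quot_cat x y \<in> Mor quot_cat" using c s x y'' by (auto simp: quot_simps)
  show "Src quot_cat (Comp quot_cat x y) = Src quot_cat x"
    using c s x y''(2) by (auto simp: quot_simps)
  show "Tgt quot_cat (Comp quot_cat x y) = Tgt quot_cat y"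
    using c s x y'' by (auto simp: quot_simps)
next
  fix x y z
  assume "x \<in> Mor quot_cat" "y \<in> Mor quot_cat" "z \<in> Mor quot_cat"
    and xy: "Tgt quot_cat x = Src quot_cat y" and yz: "Tgt quot_cat y = Src quot_cat z"
  then obtain x' y0 z0 where x: "x' \<in> Mor K" "x = mrep x'" and y0: "y0 \<in> Mor K" "y = mrep y0"
    and z0: "z0 \<in> Mor K" "z = mrep z0"
    by (auto simp: quot_simps)
  obtain y' where y': "y' \<in> Mor K" "mrep y' = y" "Tgt K x' = Src K y'"
    using lift_left[of x' y0] x y0 xy by (auto simp: quot_simps)
  have e: "orep (Tgt K y') = orep (Src K z0)"
    using yz y'(1) z0 unfolding y'(2)[symmetric] by (simp add: quot_simps)
  obtain z' where z': "z' \<in> Mor K" "mrep z' = z" "Tgt K y' = Src K z'"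
    using lift_left[OF y'(1) z0(1) e] z0(2) by metis
  show "Comp quot_cat (Comp quot_cat x y) z = Comp quot_cat x (Comp quot_cat y z)"
    using x(1) y'(1,3) z'(1,3) unfolding x(2) y'(2)[symmetric] z'(2)[symmetric]
    by (simp add: quot_comp comp_mor src_comp tgt_comp comp_assoc)
next
  fix x assume "x \<in> Mor quot_cat"
  then obtain x' where x: "x' \<in> Mor K" "x = mrep x'" by (auto simp: quot_simps)
  show "Comp quot_cat (Ident quot_cat (Src quot_cat x)) x = x"
    "Comp quot_cat x (Ident quot_cat (Tgt quot_cat x)) = x"
    using x by (auto simp: quot_simps src_obj tgt_obj quot_comp ident_mor src_ident tgt_ident
        ident_left ident_right)
qed (auto simp: quot_simps src_obj tgt_obj ident_mor src_ident tgt_ident)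

lemma is_cocone_quot_cat: "is_cocone G K \<phi>o \<phi>m quot_cat orep mrep"
  unfolding is_cocone_def is_functor_def
  using category_quot_cat by (auto simp: quot_simps quot_comp orep_act mrep_act)

lemma cocone_orep:
  assumes "is_cocone G K \<phi>o \<phi>m T fo fm" "a \<in> Obj K"
  shows "fo (orep a) = fo a"
proof -
  obtain g where "g \<in> carrier G" "orep a = \<phi>o g a" using orep_cases assms by blast
  then show ?thesis using assms by (simp add: is_cocone_def)
qed

lemma cocone_qrel:
  assumes "is_cocone G K \<phi>o \<phi>m T fo fm"
  shows "qrel m n \<Longrightarrow> fm m = fm n"
proof (induction rule: qrel.induct)
  case (qcomp x x' y y')
  have F: "is_functor K T fo fm" using assms by (simp add: is_cocone_def)
  have "fm (Comp K x y) = Comp T (fm x) (fm y)" "fm (Comp K x' y') = Comp T (fm x') (fm y')"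
    using F qrel_mor[OF qcomp.hyps(1)] qrel_mor[OF qcomp.hyps(2)] qcomp.hyps(3,4)
    by (simp_all add: is_functor_def)
  with qcomp show ?case by simp
qed (use assms in \<open>auto simp: is_cocone_def\<close>)

lemma quot_cat_universal:
  assumes co: "is_cocone G K \<phi>o \<phi>m T fo fm"
  shows "factors_uniquely K quot_cat orep mrep T fo fm"
proof -
  have m: "fm (mrep m) = fm m" if "m \<in> Mor K" for m
    using cocone_qrel[OF co mrep_qrel[OF that]] by simp
  note o = cocone_orep[OF co]
  have F: "is_functor K T fo fm" using co by (simp add: is_cocone_def)
  have "is_functor quot_cat T fo fm"
    unfolding is_functor_def
  proof (intro conjI ballI impI)
    fix x y
    assume "x \<in> Mor quot_cat" "y \<in> Mor quot_cat" and xy: "Tgt quot_cat x = Src quot_cat y"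
    then obtain x' y0 where x: "x' \<in> Mor K" "x = mrep x'" and y0: "y0 \<in> Mor K" "y = mrep y0"
      by (auto simp: quot_simps)
    obtain y' where y': "y' \<in> Mor K" "mrep y' = y" "Tgt K x' = Src K y'"
      using lift_left[of x' y0] x y0 xy by (auto simp: quot_simps)
    have "fm (Comp quot_cat x y) = fm (Comp K x' y')"
      using x(1) y'(1,3) unfolding x(2) y'(2)[symmetric] by (simp add: quot_comp m comp_mor)
    also have "\<dots> = Comp T (fm x') (fm y')"
      using F x(1) y'(1,3) by (simp add: is_functor_def)
    finally show "fm (Comp quot_cat x y) = Comp T (fm x) (fm y)"
      using x y'(1) m[of x'] m[of y'] unfolding y'(2)[symmetric] by simp
  qed (use F in \<open>auto simp: quot_simps m o ident_mor src_obj tgt_obj is_functor_def\<close>)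
  then show ?thesis
    unfolding factors_uniquely_def
    by (intro exI[of _ fo] exI[of _ fm]) (auto simp: m o quot_simps)
qed

theorem quotient_exists: "\<exists>Q qo qm. is_quotient G K \<phi>o \<phi>m Q qo qm"
  using is_cocone_quot_cat quot_cat_universal unfolding is_quotient_def by blast

end

lemma is_functor_comp:
  assumes "is_functor A B fo fm" "is_functor B C go gm"
  shows "is_functor A C (go \<circ> fo) (gm \<circ> fm)"
  using assms unfolding is_functor_def by simp

lemma is_functor_id: "is_functor A A id id"
  by (simp add: is_functor_def)

context category_action
begin

lemma quotient_iso_quot_cat:
  assumes Q: "is_quotient G K \<phi>o \<phi>m Q qo qm"
  obtains uo um where "is_functor Q quot_cat uo um"
    "\<And>a. a \<in> Obj K \<Longrightarrow> uo (qo a) = orep a" "\<And>m. m \<in> Mor K \<Longrightarrow> um (qm m) = mrep m"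
    "qo ` Obj K = Obj Q" "qm ` Mor K = Mor Q"
proof -
  have co: "is_cocone G K \<phi>o \<phi>m Q qo qm" using Q by (simp add: is_quotient_def)
  then have Qf: "is_functor K Q qo qm" by (simp add: is_cocone_def)
  have Qu: "factors_uniquely K Q qo qm quot_cat orep mrep"
    using Q is_cocone_quot_cat by (simp add: is_quotient_def)
  obtain uo um where u: "is_functor Q quot_cat uo um"
    "\<And>a. a \<in> Obj K \<Longrightarrow> uo (qo a) = orep a" "\<And>m. m \<in> Mor K \<Longrightarrow> um (qm m) = mrep m"
    using Qu unfolding factors_uniquely_def by blast
  obtain vo vm where v: "is_functor quot_cat Q vo vm"
    "\<And>a. a \<in> Obj K \<Longrightarrow> vo (orep a) = qo a" "\<And>m. m \<in> Mor K \<Longrightarrow> vm (mrep m) = qm m"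
    using quot_cat_universal[OF co] unfolding factors_uniquely_def by blast
  have uniq: "(\<forall>b\<in>Obj Q. wo b = b) \<and> (\<forall>n\<in>Mor Q. wm n = n)"
    if w: "is_functor Q Q wo wm" "\<forall>a\<in>Obj K. wo (qo a) = qo a" "\<forall>m\<in>Mor K. wm (qm m) = qm m"
    for wo wm
  proof -
    have "factors_uniquely K Q qo qm Q qo qm" using Q co by (simp add: is_quotient_def)
    then obtain xo xm where x: "\<And>vo vm. is_functor Q Q vo vm \<Longrightarrow> (\<forall>a\<in>Obj K. vo (qo a) = qo a) \<Longrightarrow>
        (\<forall>m\<in>Mor K. vm (qm m) = qm m) \<Longrightarrow> (\<forall>b\<in>Obj Q. vo b = xo b) \<and> (\<forall>n\<in>Mor Q. vm n = xm n)"
      unfolding factors_uniquely_def by blast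
    show ?thesis using x[OF w] x[OF is_functor_id] by simp
  qed
  have vu: "(\<forall>b\<in>Obj Q. (vo \<circ> uo) b = b) \<and> (\<forall>n\<in>Mor Q. (vm \<circ> um) n = n)"
    by (rule uniq) (use is_functor_comp[OF u(1) v(1)] in \<open>simp_all add: u(2,3) v(2,3) o_def\<close>)
  have "b \<in> qo ` Obj K" if "b \<in> Obj Q" for b
  proof -
    have "uo b \<in> orep ` Obj K" using u(1) that by (simp add: is_functor_def quot_simps)
    then show ?thesis using vu that v(2) by force
  qed
  moreover have "n \<in> qm ` Mor K" if "n \<in> Mor Q" for n
  proof -
    have "um n \<in> mrep ` Mor K" using u(1) that by (simp add: is_functor_def quot_simps)
    then show ?thesis using vu that v(3) by force
  qed
  ultimately show thesis
    using Qf by (intro that[OF u]) (auto simp: is_functor_def)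
qed

theorem quotient_universal:
  fixes T :: "('p, 'n) cat"
  assumes Q: "is_quotient G K \<phi>o \<phi>m Q qo qm" and T: "is_cocone G K \<phi>o \<phi>m T fo fm"
  shows "factors_uniquely K Q qo qm T fo fm"
proof -
  obtain uo um where u: "is_functor Q quot_cat uo um"
    "\<And>a. a \<in> Obj K \<Longrightarrow> uo (qo a) = orep a" "\<And>m. m \<in> Mor K \<Longrightarrow> um (qm m) = mrep m"
    and surj: "qo ` Obj K = Obj Q" "qm ` Mor K = Mor Q"
    using quotient_iso_quot_cat[OF Q] by blast
  obtain wo wm where w: "is_functor quot_cat T wo wm"
    "\<And>a. a \<in> Obj K \<Longrightarrow> wo (orep a) = fo a" "\<And>m. m \<in> Mor K \<Longrightarrow> wm (mrep m) = fm m"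
    using quot_cat_universal[OF T] unfolding factors_uniquely_def by blast
  show ?thesis
    unfolding factors_uniquely_def
    using is_functor_comp[OF u(1) w(1)] u(2,3) w(2,3)
    by (intro exI[of _ "wo \<circ> uo"] exI[of _ "wm \<circ> um"]) (auto simp: surj[symmetric])
qed

end


section \<open>Simplicial identities and the canonical map\<close>

lemma nerve_sel:
  "Simp (nerve C) = nerve_simplices C" "Face (nerve C) = nerve_face C"
  "Degen (nerve C) = nerve_degen C"
  by (simp_all add: nerve_def)

lemma nerve_simplexE:
  assumes "x \<in> nerve_simplices C k"
  obtains a where "k = 0" "x = Vertex a" "a \<in> Obj C"
  | ns where "k > 0" "x = Chain ns" "length ns = k" "\<And>i. i < k \<Longrightarrow> ns ! i \<in> Mor C"
      "\<And>i. Suc i < k \<Longrightarrow> Tgt C (ns ! i) = Src C (ns ! Suc i)"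
  using assms that unfolding nerve_simplices_def
  by (auto split: if_splits) (metis nth_mem subsetD)

lemma nerve_simplices_Chain:
  "Chain ns \<in> nerve_simplices C k \<longleftrightarrow> k > 0 \<and> length ns = k \<and> (\<forall>i<k. ns ! i \<in> Mor C) \<and>
     (\<forall>i. Suc i < k \<longrightarrow> Tgt C (ns ! i) = Src C (ns ! Suc i))"
  unfolding nerve_simplices_def by (auto simp: set_conv_nth)

lemma nerve_simplices_Vertex: "Vertex a \<in> nerve_simplices C k \<longleftrightarrow> k = 0 \<and> a \<in> Obj C"
  unfolding nerve_simplices_def by auto

context category begin

lemma nerve_face_simp:
  assumes x: "x \<in> nerve_simplices C (Suc k)" and i: "i \<le> Suc k"
  shows "nerve_face C (Suc k) i x \<in> nerve_simplices C k"
  using x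
proof (cases rule: nerve_simplexE)
  case (2 ns)
  note ns = this
  show ?thesis
  proof (cases "k = 0 \<or> i = 0 \<or> i = Suc k")
    case True
    then show ?thesis
      using ns i src_obj tgt_obj
      by (auto simp: nerve_simplices_Vertex nerve_simplices_Chain nth_tl nth_butlast)
  next
    case False
    then obtain j where j: "i = Suc j" "j < k" using i by (cases i) auto
    let ?l = "take j ns @ Comp C (ns ! j) (ns ! Suc j) # drop (Suc (Suc j)) ns"
    have c: "Comp C (ns ! j) (ns ! Suc j) \<in> Mor C"
      "Src C (Comp C (ns ! j) (ns ! Suc j)) = Src C (ns ! j)"
      "Tgt C (Comp C (ns ! j) (ns ! Suc j)) = Tgt C (ns ! Suc j)"
      using ns j by (auto simp: comp_mor src_comp tgt_comp)
    have nth: "?l ! p = (if p < j then ns ! p else if p = j then Comp C (ns ! j) (ns ! Suc j)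
        else ns ! Suc p)" if "p < k" for p
      using that j ns by (auto simp: nth_append nth_Cons' min_def)
    have "?l ! p \<in> Mor C" if "p < k" for p
      using that nth[OF that] c ns j by auto
    moreover have "Tgt C (?l ! p) = Src C (?l ! Suc p)" if "Suc p < k" for p
    proof -
      consider "Suc p < j" | "Suc p = j" | "p = j" | "p > j" by linarith
      then show ?thesis
        using that nth[of p] nth[OF that] c ns j by cases auto
    qed
    moreover have "length ?l = k" using ns j by auto
    ultimately have "Chain ?l \<in> nerve_simplices C k"
      using j by (auto simp: nerve_simplices_Chain)
    then show ?thesis using False j ns by auto
  qed
qed auto

lemma nerve_degen_simp:
  assumes x: "x \<in> nerve_simplices C k" and i: "i \<le> k"
  shows "nerve_degen C k i x \<in> nerve_simplices C (Suc k)"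
  using x
proof (cases rule: nerve_simplexE)
  case (1 a)
  then show ?thesis by (auto simp: nerve_simplices_Chain ident_mor)
next
  case (2 ns)
  note ns = this
  define e where "e = (if i < k then Src C (ns ! i) else Tgt C (ns ! (k - 1)))"
  have e: "e \<in> Obj C" "Ident C e \<in> Mor C" "Src C (Ident C e) = e" "Tgt C (Ident C e) = e"
  proof -
    show "e \<in> Obj C" using ns i unfolding e_def by (auto simp: src_obj tgt_obj)
    then show "Ident C e \<in> Mor C" "Src C (Ident C e) = e" "Tgt C (Ident C e) = e"
      by (auto simp: ident_mor src_ident tgt_ident)
  qed
  have et: "Tgt C (ns ! (i - 1)) = e" if "i > 0"
  proof (cases "i < k")
    case True
    then show ?thesis using ns(5)[of "i - 1"] that by (simp add: e_def)
  next
    case False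
    then show ?thesis using i by (simp add: e_def)
  qed
  let ?l = "take i ns @ Ident C e # drop i ns"
  have nth: "?l ! p = (if p < i then ns ! p else if p = i then Ident C e
        else ns ! (p - 1))" if "p < Suc k" for p
    using that i ns by (auto simp: nth_append nth_Cons' min_def)
  have "?l ! p \<in> Mor C" if "p < Suc k" for p
    using that nth[OF that] e ns i by auto
  moreover have "Tgt C (?l ! p) = Src C (?l ! Suc p)" if "Suc p < Suc k" for p
  proof -
    consider "Suc p < i" | "Suc p = i" | "p = i" | "p > i" by linarith
    then show ?thesis
    proof cases
      case 2
      then have "p = i - 1" "i > 0" by auto
      then show ?thesis using that nth[of p] nth[OF that] et e(3) by simp
    next
      case 4
      then show ?thesis using that nth[of p] nth[OF that] ns(5)[of "p - 1"] by auto
    qed (use that nth[of p] nth[OF that] e et ns i in \<open>auto simp: e_def\<close>)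
  qed
  moreover have "length ?l = Suc k" using ns i by auto
  ultimately have "Chain ?l \<in> nerve_simplices C (Suc k)"
    by (auto simp: nerve_simplices_Chain)
  then show ?thesis using ns by (simp add: e_def)
qed


end

text \<open>The operators in terms of chains indexed by \<open>0, \<dots>, t - 1\<close>.\<close>

context category begin

definition chain_of :: "nat \<Rightarrow> (nat \<Rightarrow> 'm) \<Rightarrow> ('o, 'm) chain" where
  "chain_of t f = Chain (map f [0..<t])"

definition idx_face :: "nat \<Rightarrow> (nat \<Rightarrow> 'm) \<Rightarrow> nat \<Rightarrow> 'm" where
  "idx_face i f p = (if Suc p < i then f p
     else if Suc p = i then Comp C (f p) (f (Suc p)) else f (Suc p))"

definition idx_degen :: "nat \<Rightarrow> nat \<Rightarrow> (nat \<Rightarrow> 'm) \<Rightarrow> nat \<Rightarrow> 'm" where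
  "idx_degen t i f p = (if p < i then f p
     else if p = i then Ident C (if i < t then Src C (f i) else Tgt C (f (t - 1)))
     else f (p - 1))"

lemma chain_of_eqI: "(\<And>p. p < t \<Longrightarrow> f p = g p) \<Longrightarrow> chain_of t f = chain_of t g"
  by (simp add: chain_of_def)

lemma nerve_simplex_cases:
  assumes "x \<in> nerve_simplices C k"
  obtains a where "k = 0" "x = Vertex a" "a \<in> Obj C"
  | f where "k > 0" "x = chain_of k f" "\<And>i. i < k \<Longrightarrow> f i \<in> Mor C"
      "\<And>i. Suc i < k \<Longrightarrow> Tgt C (f i) = Src C (f (Suc i))"
  using assms
proof (cases rule: nerve_simplexE)
  case (2 ns)
  then have "x = chain_of k ((!) ns)"
    by (auto simp: chain_of_def map_nth)
  then show thesis using 2 that(2)[of "(!) ns"] by blast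
qed (use that in blast)

lemma face_chain_of:
  assumes "t \<ge> 2" "i \<le> t"
  shows "nerve_face C t i (chain_of t f) = chain_of (t - 1) (idx_face i f)"
proof -
  consider "i = 0" | "i = t" "i \<noteq> 0" | j where "i = Suc j" "Suc j < t"
    using assms by (cases i) force+
  then show ?thesis
  proof cases
    case 3
    then show ?thesis using assms unfolding chain_of_def
      by (auto intro!: nth_equalityI simp: nth_append nth_Cons' min_def idx_face_def simp del: upt_Suc)
  qed (use assms in \<open>auto intro!: nth_equalityI simp: nth_tl nth_butlast chain_of_def idx_face_def simp del: upt_Suc\<close>)
qed

lemma face_chain_of_1:
  "nerve_face C (Suc 0) i (chain_of (Suc 0) f) = Vertex (if i = 0 then Tgt C (f 0) else Src C (f 0))"
  by (simp add: chain_of_def)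

lemma degen_chain_of:
  assumes "t > 0" "i \<le> t"
  shows "nerve_degen C t i (chain_of t f) = chain_of (Suc t) (idx_degen t i f)"
  using assms unfolding chain_of_def
  by (auto intro!: nth_equalityI simp: nth_append nth_Cons' min_def idx_degen_def simp del: upt_Suc)

lemma degen_Vertex: "nerve_degen C t i (Vertex a) = chain_of (Suc 0) (\<lambda>_. Ident C a)"
  by (simp add: chain_of_def)

lemmas chain_of_simps = face_chain_of face_chain_of_1 degen_chain_of degen_Vertex

lemma simplicial_set_nerve: "simplicial_set (nerve C)"
proof (unfold_locales, unfold nerve_sel)
  note nerve_face.simps(2) [simp del] nerve_degen.simps [simp del]
  fix x k i assume "x \<in> nerve_simplices C (Suc k)" "i \<le> Suc k"
  then show "nerve_face C (Suc k) i x \<in> nerve_simplices C k" by (rule nerve_face_simp)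
next
  fix x k i assume "x \<in> nerve_simplices C k" "i \<le> k"
  then show "nerve_degen C k i x \<in> nerve_simplices C (Suc k)" by (rule nerve_degen_simp)
next
  fix x k i j
  assume x: "x \<in> nerve_simplices C (Suc (Suc k))" and ij: "i < j" "j \<le> Suc (Suc k)"
  from x show "nerve_face C (Suc k) i (nerve_face C (Suc (Suc k)) j x) =
      nerve_face C (Suc k) (j - 1) (nerve_face C (Suc (Suc k)) i x)"
  proof (cases rule: nerve_simplex_cases)
    case (2 f)
    have c: "Src C (Comp C (f p) (f (Suc p))) = Src C (f p)"
      "Tgt C (Comp C (f p) (f (Suc p))) = Tgt C (f (Suc p))" if "p \<le> k" for p
      using 2 that by (auto simp: src_comp tgt_comp)
    have a: "Comp C (Comp C (f p) (f (Suc p))) (f (Suc (Suc p))) =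
      Comp C (f p) (Comp C (f (Suc p)) (f (Suc (Suc p))))" if "p < k" for p
      using 2 that by (auto intro!: comp_assoc)
    show ?thesis
    proof (cases "k = 0")
      case True
      then have "j = 1 \<and> i = 0 \<or> j = 2 \<and> i = 0 \<or> j = 2 \<and> i = 1" using ij by auto
      then show ?thesis using True c[of 0] 2(4)[of 0] unfolding 2(2)
        by (auto simp: chain_of_simps idx_face_def)
    next
      case False
      have "idx_face i (idx_face j f) p = idx_face (j - 1) (idx_face i f) p" if "p < k" for p
        using ij a[OF that] by (cases j) (auto simp: idx_face_def)
      then show ?thesis using 2(1) ij False unfolding 2(2)
        by (auto simp: chain_of_simps intro!: chain_of_eqI)
    qed
  qed auto
next
  fix x k i j
  assume x: "x \<in> nerve_simplices C k" and ij: "i \<le> j" "j \<le> k"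
  from x show "nerve_degen C (Suc k) i (nerve_degen C k j x) =
      nerve_degen C (Suc k) (Suc j) (nerve_degen C k i x)"
  proof (cases rule: nerve_simplex_cases)
    case (1 a)
    then show ?thesis using ij
      by (auto simp: chain_of_simps idx_degen_def src_ident tgt_ident intro!: chain_of_eqI)
  next
    case (2 f)
    have o: "Src C (f p) \<in> Obj C" "Tgt C (f p) \<in> Obj C" if "p < k" for p
      using 2 that by (auto simp: src_obj tgt_obj)
    note i = src_ident[OF o(1)] tgt_ident[OF o(1)] src_ident[OF o(2)] tgt_ident[OF o(2)]
    have "idx_degen (Suc k) i (idx_degen k j f) p = idx_degen (Suc k) (Suc j) (idx_degen k i f) p"
      if "p < Suc (Suc k)" for p
      using ij that 2(1) i by (cases p) (auto simp: idx_degen_def)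
    then show ?thesis using 2(1) ij unfolding 2(2)
        by (auto simp: chain_of_simps intro!: chain_of_eqI)
  qed
next
  fix x k i j
  assume x: "x \<in> nerve_simplices C (Suc k)" and ij: "i < j" "j \<le> Suc k"
  from x show "nerve_face C (Suc (Suc k)) i (nerve_degen C (Suc k) j x) =
      nerve_degen C k (j - 1) (nerve_face C (Suc k) i x)"
  proof (cases rule: nerve_simplex_cases)
    case (2 f)
    have c: "Src C (Comp C (f p) (f (Suc p))) = Src C (f p)"
      "Tgt C (Comp C (f p) (f (Suc p))) = Tgt C (f (Suc p))" if "p < k" for p
      using 2 that by (auto simp: src_comp tgt_comp)
    show ?thesis
    proof (cases "k = 0")
      case True
      then have "j = 1 \<and> i = 0" using ij by auto
      then show ?thesis using True unfolding 2(2)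
        by (auto simp: chain_of_simps idx_face_def idx_degen_def chain_of_def)
    next
      case False
      have "idx_face i (idx_degen (Suc k) j f) p = idx_degen k (j - 1) (idx_face i f) p"
        if "p < Suc k" for p
        using ij c that False by (cases j; cases k; cases p) (auto simp: idx_face_def idx_degen_def)
      then show ?thesis using ij False unfolding 2(2)
        by (auto simp: chain_of_simps intro!: chain_of_eqI)
    qed
  qed auto
next
  fix x k j
  assume x: "x \<in> nerve_simplices C k" and j: "j \<le> k"
  from x show "nerve_face C (Suc k) j (nerve_degen C k j x) = x"
  proof (cases rule: nerve_simplex_cases)
    case (1 a)
    then show ?thesis using j by (auto simp: chain_of_simps src_ident tgt_ident)
  next
    case (2 f)
    have "idx_face j (idx_degen k j f) p = f p" if "p < k" for p
      using that 2 j ident_right[of "f p"] by (cases j) (auto simp: idx_face_def idx_degen_def)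
    then show ?thesis using 2(1) j unfolding 2(2)
      by (auto simp: chain_of_simps intro!: chain_of_eqI)
  qed
next
  fix x k j
  assume x: "x \<in> nerve_simplices C k" and j: "j \<le> k"
  from x show "nerve_face C (Suc k) (Suc j) (nerve_degen C k j x) = x"
  proof (cases rule: nerve_simplex_cases)
    case (1 a)
    then show ?thesis using j by (auto simp: chain_of_simps src_ident tgt_ident)
  next
    case (2 f)
    have "idx_face (Suc j) (idx_degen k j f) p = f p" if "p < k" for p
      using that 2 j ident_left[of "f p"] by (auto simp: idx_face_def idx_degen_def)
    then show ?thesis using 2(1) j unfolding 2(2)
      by (auto simp: chain_of_simps intro!: chain_of_eqI)
  qed
next
  fix x k i j
  assume x: "x \<in> nerve_simplices C (Suc k)" and ij: "Suc j < i" "i \<le> Suc (Suc k)"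
  from x show "nerve_face C (Suc (Suc k)) i (nerve_degen C (Suc k) j x) =
      nerve_degen C k j (nerve_face C (Suc k) (i - 1) x)"
  proof (cases rule: nerve_simplex_cases)
    case (2 f)
    have c: "Src C (Comp C (f p) (f (Suc p))) = Src C (f p)"
      "Tgt C (Comp C (f p) (f (Suc p))) = Tgt C (f (Suc p))" if "p < k" for p
      using 2 that by (auto simp: src_comp tgt_comp)
    show ?thesis
    proof (cases "k = 0")
      case True
      then have "i = 2 \<and> j = 0" using ij by auto
      then show ?thesis using True unfolding 2(2)
        by (auto simp: chain_of_simps idx_face_def idx_degen_def chain_of_def)
    next
      case False
      have "idx_face i (idx_degen (Suc k) j f) p = idx_degen k j (idx_face (i - 1) f) p"
        if "p < Suc k" for p
        using ij c that False 2(4) by (cases "p = k"; cases i; cases p) (auto simp: idx_face_def idx_degen_def)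
      then show ?thesis using ij False unfolding 2(2)
        by (auto simp: chain_of_simps intro!: chain_of_eqI)
    qed
  qed auto
qed

end

lemma nerve_map_face:
  assumes F: "is_functor C D fo fm" and x: "x \<in> nerve_simplices C (Suc k)" and i: "i \<le> Suc k"
  shows "nerve_map fo fm (nerve_face C (Suc k) i x) = nerve_face D (Suc k) i (nerve_map fo fm x)"
  using x
proof (cases rule: nerve_simplexE)
  case (2 ns)
  then show ?thesis using F i
    by (auto simp: is_functor_def map_tl map_butlast take_map drop_map)
qed auto

lemma nerve_map_degen:
  assumes "category C" and F: "is_functor C D fo fm" and x: "x \<in> nerve_simplices C k" and i: "i \<le> k"
  shows "nerve_map fo fm (nerve_degen C k i x) = nerve_degen D k i (nerve_map fo fm x)"
  using x
proof (cases rule: nerve_simplexE)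
  case (1 a)
  then show ?thesis using F by (simp add: is_functor_def)
next
  case (2 ns)
  interpret category C by fact
  show ?thesis using F i 2
    by (auto simp: is_functor_def take_map drop_map src_obj tgt_obj)
qed

lemma nerve_map_simplices:
  assumes F: "is_functor C D fo fm" and x: "x \<in> nerve_simplices C k"
  shows "nerve_map fo fm x \<in> nerve_simplices D k"
  using x
  by (cases rule: nerve_simplexE)
    (use F in \<open>auto simp: nerve_simplices_Vertex nerve_simplices_Chain is_functor_def\<close>)

context category_action
begin

lemma act_nerve_simplices:
  assumes "g \<in> carrier G" "x \<in> nerve_simplices K k"
  shows "nerve_map (\<phi>o g) (\<phi>m g) x \<in> nerve_simplices K k"
  using nerve_map_simplices[OF action_functor] assms by blast

lemma nerve_orbit_subset:
  assumes "S \<in> Simp (nerve_quotient G K \<phi>o \<phi>m) k"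
  shows "S \<subseteq> nerve_simplices K k"
  using assms act_nerve_simplices
  by (auto simp: nerve_quotient_def sset_quotient_def orbits_def orbit_def nerve_sel)

lemma simplicial_set_nerve_quotient: "simplicial_set (nerve_quotient G K \<phi>o \<phi>m)"
proof -
  interpret N: simplicial_set "nerve K" by (rule simplicial_set_nerve)
  let ?\<psi> = "\<lambda>g. nerve_map (\<phi>o g) (\<phi>m g)" and ?X = "nerve_quotient G K \<phi>o \<phi>m"
  have FD: "Face ?X k i S = Face (nerve K) k i ` S" "Degen ?X k i S = Degen (nerve K) k i ` S" for k i S
    by (simp_all add: nerve_quotient_def sset_quotient_def)
  have S: "Simp ?X k = {orbit G ?\<psi> x | x. x \<in> Simp (nerve K) k}" for k
    by (simp add: nerve_quotient_def sset_quotient_def orbits_def)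
  have sub: "y \<in> Simp (nerve K) k" if "S \<in> Simp ?X k" "y \<in> S" for S k y
    using nerve_orbit_subset that by (auto simp: nerve_sel)
  have face: "Face (nerve K) (Suc k) i ` orbit G ?\<psi> x = orbit G ?\<psi> (Face (nerve K) (Suc k) i x)"
    if "x \<in> Simp (nerve K) (Suc k)" "i \<le> Suc k" for k i x
    using that nerve_map_face[OF action_functor]
    by (auto simp: orbit_def nerve_sel) (metis (mono_tags, lifting) imageI mem_Collect_eq)
  have degen: "Degen (nerve K) k i ` orbit G ?\<psi> x = orbit G ?\<psi> (Degen (nerve K) k i x)"
    if "x \<in> Simp (nerve K) k" "i \<le> k" for k i x
    using that nerve_map_degen[OF category_axioms action_functor]
    by (auto simp: orbit_def nerve_sel) (metis (mono_tags, lifting) imageI mem_Collect_eq)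
  show ?thesis
  proof (unfold_locales, unfold FD image_image)
    fix k i S assume "S \<in> Simp ?X (Suc k)" "i \<le> Suc k"
    then show "Face (nerve K) (Suc k) i ` S \<in> Simp ?X k"
      using face N.face_simp unfolding S by blast
  next
    fix k i S assume "S \<in> Simp ?X k" "i \<le> k"
    then show "Degen (nerve K) k i ` S \<in> Simp ?X (Suc k)"
      using degen N.degen_simp unfolding S by blast
  qed (auto simp: N.face_face N.degen_degen N.face_degen_less N.face_degen_same N.face_degen_Suc
      N.face_degen_greater sub cong: image_cong_simp)
qed

lemma canonical_map_orbit:
  assumes "is_cocone G K \<phi>o \<phi>m Q qo qm" and x: "x \<in> nerve_simplices K k"
  shows "canonical_map qo qm (orbit G (\<lambda>g. nerve_map (\<phi>o g) (\<phi>m g)) x) = nerve_map qo qm x"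
proof -
  interpret group G using obj.group_hom group_hom.axioms(1) by auto
  have *: "nerve_map qo qm (nerve_map (\<phi>o g) (\<phi>m g) x) = nerve_map qo qm x" if "g \<in> carrier G" for g
    using x
  proof (cases rule: nerve_simplexE)
    case (2 ns)
    then show ?thesis using assms(1) that by (auto simp: is_cocone_def in_set_conv_nth)
  qed (use assms(1) that in \<open>auto simp: is_cocone_def\<close>)
  let ?O = "orbit G (\<lambda>g. nerve_map (\<phi>o g) (\<phi>m g)) x"
  have "nerve_map qo qm ` ?O = (\<lambda>_. nerve_map qo qm x) ` ?O"
    by (rule image_cong) (auto simp: orbit_def *)
  moreover have "nerve_map (\<phi>o \<one>) (\<phi>m \<one>) x \<in> ?O"
    by (auto simp: orbit_def)
  ultimately have "nerve_map qo qm ` ?O = {nerve_map qo qm x}"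
    by (auto simp: image_constant_conv split: if_splits)
  then show ?thesis by (simp add: canonical_map_def)
qed

lemma canonical_map_surjective:
  assumes Q: "is_quotient G K \<phi>o \<phi>m Q qo qm"
  shows "canonical_map qo qm ` Simp (nerve_quotient G K \<phi>o \<phi>m) k = Simp (nerve Q) k"
proof -
  have co: "is_cocone G K \<phi>o \<phi>m Q qo qm" using Q by (simp add: is_quotient_def)
  then have F: "is_functor K Q qo qm" by (simp add: is_cocone_def)
  obtain uo um where u: "is_functor Q quot_cat uo um"
    "\<And>a. a \<in> Obj K \<Longrightarrow> uo (qo a) = orep a" "\<And>m. m \<in> Mor K \<Longrightarrow> um (qm m) = mrep m"
    and surj: "qo ` Obj K = Obj Q" "qm ` Mor K = Mor Q"
    using quotient_iso_quot_cat[OF Q] by blast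
  have lift: "\<exists>ms. Chain ms \<in> nerve_simplices K (Suc t) \<and> map qm ms = ns"
    if "Chain ns \<in> nerve_simplices Q (Suc t)" for ns t
    using that
  proof (induction t arbitrary: ns)
    case 0
    then have "ns = [ns ! 0]" "ns ! 0 \<in> Mor Q"
      by (auto simp: nerve_simplices_Chain length_Suc_conv)
    then obtain m where "m \<in> Mor K" "qm m = ns ! 0" using surj(2) by (metis imageE)
    then show ?case using \<open>ns = [ns ! 0]\<close>
      by (intro exI[of _ "[m]"]) (auto simp: nerve_simplices_Chain)
  next
    case (Suc t)
    then have ns: "length ns = Suc (Suc t)" "\<And>i. i < Suc (Suc t) \<Longrightarrow> ns ! i \<in> Mor Q"
      "\<And>i. i < Suc t \<Longrightarrow> Tgt Q (ns ! i) = Src Q (ns ! Suc i)"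
      by (auto simp: nerve_simplices_Chain)
    have "Chain (take (Suc t) ns) \<in> nerve_simplices Q (Suc t)"
      using ns by (auto simp: nerve_simplices_Chain)
    then obtain ms where ms: "Chain ms \<in> nerve_simplices K (Suc t)" "map qm ms = take (Suc t) ns"
      using Suc.IH by blast
    then have ms': "length ms = Suc t" "\<And>i. i < Suc t \<Longrightarrow> ms ! i \<in> Mor K"
      by (auto simp: nerve_simplices_Chain)
    have mt: "ms ! t \<in> Mor K" "qm (ms ! t) = ns ! t"
      using ms' arg_cong[OF ms(2), of "\<lambda>l. l ! t"] by auto
    obtain y where y: "y \<in> Mor K" "qm y = ns ! Suc t" using ns(2)[of "Suc t"] surj by force
    have "qo (Tgt K (ms ! t)) = qo (Src K y)"
    proof -
      have "Tgt Q (qm (ms ! t)) = qo (Tgt K (ms ! t))" "Src Q (qm y) = qo (Src K y)"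
        using F mt(1) y(1) by (auto simp: is_functor_def)
      then show ?thesis using ns(3)[of t] mt(2) y(2) by simp
    qed
    then have "orep (Tgt K (ms ! t)) = orep (Src K y)"
      using u(2) mt(1) y(1) by (metis src_obj tgt_obj)
    then obtain y' where y': "y' \<in> Mor K" "Tgt K (ms ! t) = Src K y'" "\<exists>g\<in>carrier G. y' = \<phi>m g y"
      using lift_left mt(1) y(1) by metis
    have "qm y' = ns ! Suc t" using y' y co by (auto simp: is_cocone_def)
    then have "map qm (ms @ [y']) = ns"
      using ms(2) ns(1) by (simp add: take_Suc_conv_app_nth[of "Suc t" ns, symmetric])
    moreover have "Chain (ms @ [y']) \<in> nerve_simplices K (Suc (Suc t))"
      using ms(1) y' by (auto simp: nerve_simplices_Chain nth_append less_Suc_eq)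
    ultimately show ?case by blast
  qed
  have "nerve_map qo qm ` nerve_simplices K k = nerve_simplices Q k"
  proof (intro equalityI subsetI)
    fix z assume "z \<in> nerve_simplices Q k"
    then show "z \<in> nerve_map qo qm ` nerve_simplices K k"
    proof (cases rule: nerve_simplexE)
      case (1 b)
      then obtain a where "a \<in> Obj K" "qo a = b" using surj(1) 1(3) by (metis imageE)
      then show ?thesis using 1 by (intro image_eqI[of _ _ "Vertex a"]) (auto simp: nerve_simplices_Vertex)
    next
      case (2 ns)
      then obtain t where t: "k = Suc t" by (cases k) auto
      then obtain ms where "Chain ms \<in> nerve_simplices K k" "map qm ms = ns"
        using lift[of ns t] 2(2) \<open>z \<in> nerve_simplices Q k\<close> by auto
      then show ?thesis using 2(2) by (intro image_eqI[of _ _ "Chain ms"]) auto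
    qed
  qed (use nerve_map_simplices[OF F] in auto)
  moreover have "canonical_map qo qm ` Simp (nerve_quotient G K \<phi>o \<phi>m) k =
      nerve_map qo qm ` nerve_simplices K k"
  proof -
    have "Simp (nerve_quotient G K \<phi>o \<phi>m) k =
        orbit G (\<lambda>g. nerve_map (\<phi>o g) (\<phi>m g)) ` nerve_simplices K k"
      by (auto simp: nerve_quotient_def sset_quotient_def orbits_def nerve_sel)
    then show ?thesis
      by (simp add: image_image canonical_map_orbit[OF co] cong: image_cong_simp)
  qed
  ultimately show ?thesis by (simp add: nerve_sel)
qed

end

end

theory Submission
  imports Defs
begin

text \<open>The fibres of \<open>K \<rightarrow> K/G\<close> on morphisms are the classes of the smallest congruence \<open>qrel\<close>
  containing the orbit relation.  Condition (R) says that the orbit relation is compatible with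
  composition, that is, that it already is this congruence: if \<open>Tgt x = Src y\<close> and
  \<open>Tgt (g x) = Src (h y)\<close>, then (R) for \<open>g x\<close>, \<open>g y\<close>, \<open>h y\<close> moves \<open>g x \<circ> h y\<close> into the orbit of
  \<open>g x \<circ> g y = g (x \<circ> y)\<close>.  Conversely, \<open>[x \<circ> y]\<close> depends on \<open>y\<close> only through \<open>[y]\<close>, so that
  injectivity of \<open>\<lambda>\<close> on \<open>1\<close>-simplices gives (R).  Hence (R) is equivalent to injectivity
  of \<open>\<lambda>\<close> in dimension \<open>1\<close> (\<open>quotient_mor_eqD\<close>, \<open>qrel_orbit_eq\<close>, \<open>condition_R_if_inj\<close>).

  It remains to deduce from (R) that \<open>\<lambda>\<close> is injective on the simplices of the \<open>1\<close>-skeleton in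
  every dimension.  These are orbits of chains with at most one non-identity morphism
  (\<open>skeleton_one_near_identity\<close>).  If two such chains have morphisms in the same orbits, then their
  identities are at the same positions, and any \<open>g\<close> that matches the exceptional morphisms matches
  the chains, as all other entries are identities of the endpoints of the exceptional one
  (\<open>act_near_identity_chain\<close>).\<close>


section \<open>Orbits and the fibres of the quotient functor\<close>

context category_action
begin

text \<open>The induced action on the nerve is not an instance of \<open>group_action\<close>, since the maps
  \<open>nerve_map (\<phi>o g) (\<phi>m g)\<close> need not be \<open>undefined\<close> outside of the nerve.\<close>

lemma nerve_orbit_act:
  assumes x: "x \<in> nerve_simplices K k" and g: "g \<in> carrier G"
  shows "orbit G (\<lambda>g. nerve_map (\<phi>o g) (\<phi>m g)) (nerve_map (\<phi>o g) (\<phi>m g) x) =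
    orbit G (\<lambda>g. nerve_map (\<phi>o g) (\<phi>m g)) x"
proof -
  interpret group G using obj.group_hom group_hom.axioms(1) by auto
  let ?\<psi> = "\<lambda>g. nerve_map (\<phi>o g) (\<phi>m g)"
  have comp: "?\<psi> h (?\<psi> g x) = ?\<psi> (h \<otimes> g) x" if "h \<in> carrier G" for h
    using x
  proof (cases rule: nerve_simplexE)
    case (1 a)
    then show ?thesis using obj.composition_rule[OF _ that g] by simp
  next
    case (2 ns)
    then show ?thesis using mor.composition_rule[OF _ that g] by (auto simp: in_set_conv_nth)
  qed
  have "?\<psi> h x = ?\<psi> (h \<otimes> inv g) (?\<psi> g x)" if "h \<in> carrier G" for h
    using comp[of "h \<otimes> inv g"] that g by (simp add: m_assoc)
  then have "?\<psi> h x \<in> orbit G ?\<psi> (?\<psi> g x)" if "h \<in> carrier G" for h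
    unfolding orbit_def using that g by blast
  moreover have "?\<psi> h (?\<psi> g x) \<in> orbit G ?\<psi> x" if "h \<in> carrier G" for h
    unfolding orbit_def using comp that g by blast
  ultimately show ?thesis by (auto simp: orbit_def)
qed

lemma orbit_morE:
  assumes "m \<in> Mor K" "n \<in> Mor K" "orbit G \<phi>m m = orbit G \<phi>m n"
  obtains g where "g \<in> carrier G" "n = \<phi>m g m"
  using mor.orbit_refl[OF assms(2)] assms(3) that by (auto simp: orbit_def)

text \<open>Under (R), the orbit relation is a congruence.\<close>

lemma qrel_orbit_eq:
  assumes R: "condition_R G K \<phi>m"
  shows "qrel m n \<Longrightarrow> orbit G \<phi>m m = orbit G \<phi>m n"
proof (induction rule: qrel.induct)
  case (qact m g)
  then show ?case by (rule mor.orbit_eqI)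
next
  case (qcomp x x' y y')
  have mor: "x \<in> Mor K" "x' \<in> Mor K" "y \<in> Mor K" "y' \<in> Mor K"
    using qrel_mor qcomp.hyps by blast+
  obtain g where g: "g \<in> carrier G" "x' = \<phi>m g x"
    using orbit_morE[OF mor(1,2) qcomp.IH(1)] .
  have gy: "\<phi>m g y \<in> Mor K" "Tgt K x' = Src K (\<phi>m g y)"
    using g mor qcomp.hyps(3) by (simp_all add: act_mor)
  have "orbit G \<phi>m (\<phi>m g y) = orbit G \<phi>m y'"
    using mor.orbit_eqI[OF mor(3) g(1)] qcomp.IH(2) by simp
  then have "orbit G \<phi>m (Comp K x' y') = orbit G \<phi>m (Comp K x' (\<phi>m g y))"
    using R mor gy qcomp.hyps(4) unfolding condition_R_def by metis
  also have "Comp K x' (\<phi>m g y) = \<phi>m g (Comp K x y)"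
    using action_functor[OF g(1)] mor qcomp.hyps(3) unfolding g(2) is_functor_def by simp
  also have "orbit G \<phi>m (\<phi>m g (Comp K x y)) = orbit G \<phi>m (Comp K x y)"
    using mor.orbit_eqI comp_mor mor qcomp.hyps(3) g(1) by blast
  finally show ?case ..
qed simp_all

lemma quotient_obj_eqE:
  assumes Q: "is_quotient G K \<phi>o \<phi>m Q qo qm"
    and "a \<in> Obj K" "b \<in> Obj K" "qo a = qo b"
  obtains g where "g \<in> carrier G" "b = \<phi>o g a"
proof -
  obtain uo um where "is_functor Q quot_cat uo um" and
    u: "\<And>a. a \<in> Obj K \<Longrightarrow> uo (qo a) = orep a"
    by (rule quotient_iso_quot_cat[OF Q]) (rule that)
  have "orep b = orep a" using u[OF assms(2)] u[OF assms(3)] assms(4) by simp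
  then obtain g where "g \<in> carrier G" "\<phi>o g a = b" by (rule orep_eqD[OF assms(3,2)])
  then show thesis using that by simp
qed

lemma quotient_mor_eqD:
  assumes Q: "is_quotient G K \<phi>o \<phi>m Q qo qm"
    and "m \<in> Mor K" "n \<in> Mor K" "qm m = qm n"
  shows "qrel m n"
proof -
  obtain uo um where "is_functor Q quot_cat uo um" and
    u: "\<And>m. m \<in> Mor K \<Longrightarrow> um (qm m) = mrep m"
    by (rule quotient_iso_quot_cat[OF Q]) (rule that)
  have "mrep m = mrep n" using u[OF assms(2)] u[OF assms(3)] assms(4) by simp
  then show ?thesis by (rule mrep_eqD[OF assms(2,3)])
qed

end


section \<open>The 1-skeleton\<close>

text \<open>A simplex of the nerve with at most one non-identity entry.  The position \<open>p\<close> of the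
  exceptional entry may exceed the length of the chain, and vertices count as near-identity.\<close>

fun near_identity :: "('o, 'm) cat \<Rightarrow> ('o, 'm) chain \<Rightarrow> bool" where
  "near_identity C (Vertex a) \<longleftrightarrow> True"
| "near_identity C (Chain ns) \<longleftrightarrow>
     (\<exists>p. \<forall>i<length ns. i \<noteq> p \<longrightarrow> ns ! i \<in> Ident C ` Obj C)"

context category
begin

lemma near_identity_chain_of:
  "near_identity C (chain_of t f) \<longleftrightarrow> (\<exists>p. \<forall>i<t. i \<noteq> p \<longrightarrow> f i \<in> Ident C ` Obj C)"
  by (simp add: chain_of_def)

lemma near_identity_low_dim:
  assumes "x \<in> nerve_simplices C k" "k \<le> 1"
  shows "near_identity C x"
  using assms(1) by (cases rule: nerve_simplexE) (use assms(2) in \<open>auto intro: exI[of _ 0]\<close>)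

lemma near_identity_face:
  assumes x: "x \<in> nerve_simplices C (Suc k)" and "near_identity C x" and i: "i \<le> Suc k"
  shows "near_identity C (nerve_face C (Suc k) i x)"
  using x
proof (cases rule: nerve_simplex_cases)
  case (2 f)
  show ?thesis
  proof (cases "k = 0")
    case True
    then show ?thesis using 2(2) by (simp add: face_chain_of_1)
  next
    case False
    obtain p where p: "\<And>j. j < Suc k \<Longrightarrow> j \<noteq> p \<Longrightarrow> f j \<in> Ident C ` Obj C"
      using assms(2) 2(2) by (auto simp: near_identity_chain_of)
    \<comment> \<open>The exceptional entry moves one place to the left if it is right of the contracted
      vertex \<open>i\<close>.\<close>
    have "idx_face i f q \<in> Ident C ` Obj C"
      if q: "q < k" "q \<noteq> (if p < i then p else p - 1)" for q
    proof -
      consider "Suc q < i" | "Suc q = i" | "Suc q > i" by linarith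
      then show ?thesis
      proof cases
        case 1
        then show ?thesis using p[of q] q by (auto simp: idx_face_def split: if_splits)
      next
        case eq: 2
        then have "f q \<in> Ident C ` Obj C" "f (Suc q) \<in> Ident C ` Obj C"
          using p[of q] p[of "Suc q"] q by (auto split: if_splits)
        then obtain a b where "a \<in> Obj C" "f q = Ident C a" "b \<in> Obj C" "f (Suc q) = Ident C b"
          by blast
        moreover from this have "a = b"
          using 2(4)[of q] q by (simp add: src_ident tgt_ident)
        ultimately have "Comp C (f q) (f (Suc q)) = Ident C a"
          using ident_left[OF ident_mor, of a] by (simp add: src_ident)
        then show ?thesis using eq \<open>a \<in> Obj C\<close> by (simp add: idx_face_def)
      next
        case 3
        then show ?thesis using p[of "Suc q"] q by (auto simp: idx_face_def split: if_splits)
      qed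
    qed
    then show ?thesis using False i 2(2)
      by (auto simp: face_chain_of near_identity_chain_of)
  qed
qed simp

lemma near_identity_degen:
  assumes x: "x \<in> nerve_simplices C k" and "near_identity C x" and i: "i \<le> k"
  shows "near_identity C (nerve_degen C k i x)"
  using x
proof (cases rule: nerve_simplex_cases)
  case (2 f)
  obtain p where p: "\<And>j. j < k \<Longrightarrow> j \<noteq> p \<Longrightarrow> f j \<in> Ident C ` Obj C"
    using assms(2) 2(2) by (auto simp: near_identity_chain_of)
  have "idx_degen k i f q \<in> Ident C ` Obj C"
    if q: "q < Suc k" "q \<noteq> (if p < i then p else Suc p)" for q
  proof -
    consider "q < i" | "q = i" | "q > i" by linarith
    then show ?thesis
    proof cases
      case 1
      then show ?thesis using p[of q] q i by (auto simp: idx_degen_def split: if_splits)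
    next
      case eq: 2
      have "(if i < k then Src C (f i) else Tgt C (f (k - 1))) \<in> Obj C"
        using 2(1,3) by (auto intro: src_obj tgt_obj)
      then show ?thesis using eq by (simp add: idx_degen_def)
    next
      case 3
      then show ?thesis using p[of "q - 1"] q by (auto simp: idx_degen_def split: if_splits)
    qed
  qed
  then show ?thesis using i 2(1,2)
    by (auto simp: degen_chain_of near_identity_chain_of)
qed (auto intro: exI[of _ 0])

end

context category_action
begin

lemma skeleton_one_near_identity:
  assumes "S \<in> skeleton 1 (nerve_quotient G K \<phi>o \<phi>m) t"
  shows "S \<in> Simp (nerve_quotient G K \<phi>o \<phi>m) t \<and> (\<forall>x\<in>S. near_identity K x)"
proof -
  let ?X = "nerve_quotient G K \<phi>o \<phi>m"
  interpret X: simplicial_set ?X by (rule simplicial_set_nerve_quotient)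
  have ops: "Face ?X k i S = nerve_face K k i ` S" "Degen ?X k i S = nerve_degen K k i ` S"
    for k i S
    by (simp_all add: nerve_quotient_def sset_quotient_def nerve_sel)
  have "(t, S) \<in> skeleton_rel 1 ?X" using assms by (simp add: skeleton_def)
  then show ?thesis
  proof (induction t S rule: skeleton_rel.induct)
    case (base k S)
    then show ?case using near_identity_low_dim nerve_orbit_subset by blast
  next
    case (face k S i)
    then have "S \<subseteq> nerve_simplices K (Suc k)" using nerve_orbit_subset by blast
    then show ?case
      using face X.face_simp[of S k i] near_identity_face by (auto simp: ops)
  next
    case (degen k S i)
    then have "S \<subseteq> nerve_simplices K k" using nerve_orbit_subset by blast
    then show ?case
      using degen X.degen_simp[of S k i] near_identity_degen by (auto simp: ops)
  qed
qed

lemma act_is_identity: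
  assumes "m \<in> Ident K ` Obj K" "g \<in> carrier G"
  shows "\<phi>m g m \<in> Ident K ` Obj K"
  using assms act_ident act_obj by force

text \<open>Two near-identity chains whose entries lie pairwise in the same orbits differ by a single
  group element.  This fails for general chains, where each entry may need its own element.\<close>

lemma act_near_identity_chain:
  assumes ns: "Chain ns \<in> nerve_simplices K t" and ms: "Chain ms \<in> nerve_simplices K t"
    and near: "near_identity K (Chain ns)"
    and orb: "\<And>i. i < t \<Longrightarrow> orbit G \<phi>m (ns ! i) = orbit G \<phi>m (ms ! i)"
  obtains g where "g \<in> carrier G" "ms = map (\<phi>m g) ns"
proof -
  have len: "t > 0" "length ns = t" "length ms = t"
    and mor: "\<And>i. i < t \<Longrightarrow> ns ! i \<in> Mor K" "\<And>i. i < t \<Longrightarrow> ms ! i \<in> Mor K"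
    and adj: "\<And>i. Suc i < t \<Longrightarrow> Tgt K (ns ! i) = Src K (ns ! Suc i)"
      "\<And>i. Suc i < t \<Longrightarrow> Tgt K (ms ! i) = Src K (ms ! Suc i)"
    using ns ms by (auto simp: nerve_simplices_Chain)
  obtain p where p: "p < t" "\<And>i. i < t \<Longrightarrow> i \<noteq> p \<Longrightarrow> ns ! i \<in> Ident K ` Obj K"
  proof -
    obtain p where p: "\<And>i. i < t \<Longrightarrow> i \<noteq> p \<Longrightarrow> ns ! i \<in> Ident K ` Obj K"
      using near len by auto
    show thesis using that[of "if p < t then p else 0"] p len(1) by (auto split: if_splits)
  qed
  have p': "ms ! i \<in> Ident K ` Obj K" if "i < t" "i \<noteq> p" for i
    using orbit_morE[OF mor(1,2) orb] act_is_identity p(2) that by metis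
  obtain g where g: "g \<in> carrier G" "ms ! p = \<phi>m g (ns ! p)"
    using orbit_morE[OF mor(1,2) orb] p(1) by metis
  have idI: "y = \<phi>m g x"
    if "x \<in> Ident K ` Obj K" "y \<in> Ident K ` Obj K"
      "Src K y = \<phi>o g (Src K x) \<or> Tgt K y = \<phi>o g (Tgt K x)" for x y
    using that g(1) by (auto simp: src_ident tgt_ident act_ident)
  \<comment> \<open>The equality spreads from position \<open>p\<close> in both directions, since an identity is determined by
    either of its endpoints.\<close>
  have right: "p + d < t \<Longrightarrow> ms ! (p + d) = \<phi>m g (ns ! (p + d))" for d
  proof (induction d)
    case (Suc d)
    then have "Src K (ms ! (p + Suc d)) = \<phi>o g (Src K (ns ! (p + Suc d)))"
      using adj[of "p + d"] mor(1)[of "p + d"] g(1) by (simp add: act_mor)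
    then show ?case using idI p(2) p' Suc.prems by simp
  qed (simp add: g)
  have left: "d \<le> p \<Longrightarrow> ms ! (p - d) = \<phi>m g (ns ! (p - d))" for d
  proof (induction d)
    case (Suc d)
    then have e: "Suc (p - Suc d) = p - d" by simp
    have "Tgt K (ms ! (p - Suc d)) = \<phi>o g (Tgt K (ns ! (p - Suc d)))"
      using adj[of "p - Suc d"] mor(1)[of "p - d"] Suc p(1) g(1) unfolding e
      by (simp add: act_mor)
    then show ?case using idI p p' Suc.prems by simp
  qed (simp add: g)
  have "ms ! i = \<phi>m g (ns ! i)" if "i < t" for i
    using left[of "p - i"] right[of "i - p"] that by (cases "i \<le> p") auto
  then have "ms = map (\<phi>m g) ns" using len by (auto intro: nth_equalityI)
  then show thesis using that g(1) by blast
qed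


section \<open>Condition (R) and injectivity of the canonical map\<close>

lemma inj_on_skeleton_if_condition_R:
  assumes Q: "is_quotient G K \<phi>o \<phi>m Q qo qm" and R: "condition_R G K \<phi>m"
  shows "inj_on (canonical_map qo qm) (skeleton 1 (nerve_quotient G K \<phi>o \<phi>m) t)"
proof (rule inj_onI)
  let ?\<psi> = "\<lambda>g. nerve_map (\<phi>o g) (\<phi>m g)" and ?X = "nerve_quotient G K \<phi>o \<phi>m"
  have co: "is_cocone G K \<phi>o \<phi>m Q qo qm" using Q by (simp add: is_quotient_def)
  interpret group G using obj.group_hom group_hom.axioms(1) by auto
  fix S S' assume S: "S \<in> skeleton 1 ?X t" and S': "S' \<in> skeleton 1 ?X t"
    and eq: "canonical_map qo qm S = canonical_map qo qm S'"
  have rep: "\<exists>x\<in>nerve_simplices K t. T = orbit G ?\<psi> x \<and> near_identity K x"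
    if T: "T \<in> skeleton 1 ?X t" for T
  proof -
    obtain x where x: "x \<in> nerve_simplices K t" "T = orbit G ?\<psi> x"
      using skeleton_one_near_identity[OF T]
      by (auto simp: nerve_quotient_def sset_quotient_def orbits_def nerve_sel)
    \<comment> \<open>The image of \<open>x\<close> under the unit of \<open>G\<close> represents the same orbit and lies in it.\<close>
    have "?\<psi> \<one> x \<in> T" using x(2) by (auto simp: orbit_def)
    then have "near_identity K (?\<psi> \<one> x)" using skeleton_one_near_identity[OF T] by blast
    then show ?thesis
      using nerve_orbit_act[OF x(1) one_closed] act_nerve_simplices[OF one_closed x(1)] x(2)
      by blast
  qed
  obtain x where x: "x \<in> nerve_simplices K t" "S = orbit G ?\<psi> x" "near_identity K x"
    using rep[OF S] by blast
  obtain y where y: "y \<in> nerve_simplices K t" "S' = orbit G ?\<psi> y"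
    using rep[OF S'] by blast
  have xy: "nerve_map qo qm x = nerve_map qo qm y"
    using eq canonical_map_orbit[OF co x(1)] canonical_map_orbit[OF co y(1)] x(2) y(2) by simp
  have "\<exists>g\<in>carrier G. y = ?\<psi> g x"
    using x(1)
  proof (cases rule: nerve_simplexE)
    case (1 a)
    then obtain b where b: "y = Vertex b" "b \<in> Obj K"
      using y(1) by (auto elim: nerve_simplexE)
    then show ?thesis using quotient_obj_eqE[OF Q, of a b] xy 1 by auto
  next
    case (2 ns)
    then obtain ms where ms: "y = Chain ms" "length ms = t" "\<And>i. i < t \<Longrightarrow> ms ! i \<in> Mor K"
      using y(1) by (auto elim: nerve_simplexE)
    have "map qm ns = map qm ms" using xy 2(2) ms(1) by simp
    then have "qm (ns ! i) = qm (ms ! i)" if "i < t" for i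
      using 2(3) ms(2) that by (metis nth_map)
    then have "orbit G \<phi>m (ns ! i) = orbit G \<phi>m (ms ! i)" if "i < t" for i
      using qrel_orbit_eq[OF R quotient_mor_eqD[OF Q]] 2(4) ms(3) that by blast
    then obtain g where "g \<in> carrier G" "ms = map (\<phi>m g) ns"
      using act_near_identity_chain[of ns t ms] x(1,3) y(1) 2(2) ms(1) by blast
    then show ?thesis using 2(2) ms(1) by auto
  qed
  then show "S = S'" using nerve_orbit_act[OF x(1)] x(2) y(2) by auto
qed

lemma condition_R_if_inj:
  assumes co: "is_cocone G K \<phi>o \<phi>m Q qo qm"
    and inj: "inj_on (canonical_map qo qm) (Simp (nerve_quotient G K \<phi>o \<phi>m) 1)"
  shows "condition_R G K \<phi>m"
  unfolding condition_R_def
proof (intro ballI impI, elim conjE)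
  let ?\<psi> = "\<lambda>g. nerve_map (\<phi>o g) (\<phi>m g)"
  fix x ya yb assume mor: "x \<in> Mor K" "ya \<in> Mor K" "yb \<in> Mor K"
    and t: "Tgt K x = Src K ya" "Tgt K x = Src K yb" and orb: "orbit G \<phi>m ya = orbit G \<phi>m yb"
  have F: "is_functor K Q qo qm" using co by (simp add: is_cocone_def)
  obtain g where "g \<in> carrier G" "yb = \<phi>m g ya" using orbit_morE[OF mor(2,3) orb] .
  then have "qm ya = qm yb" using co mor(2) by (simp add: is_cocone_def)
  then have "qm (Comp K x ya) = qm (Comp K x yb)"
    using F mor t by (simp add: is_functor_def)
  moreover have simp: "Chain [Comp K x ya] \<in> nerve_simplices K 1"
    "Chain [Comp K x yb] \<in> nerve_simplices K 1"
    using mor t by (simp_all add: nerve_simplices_Chain comp_mor)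
  ultimately have "canonical_map qo qm (orbit G ?\<psi> (Chain [Comp K x ya])) =
      canonical_map qo qm (orbit G ?\<psi> (Chain [Comp K x yb]))"
    by (simp add: canonical_map_orbit[OF co simp(1)] canonical_map_orbit[OF co simp(2)])
  moreover have "orbit G ?\<psi> z \<in> Simp (nerve_quotient G K \<phi>o \<phi>m) 1"
    if "z \<in> nerve_simplices K 1" for z
    using that by (auto simp: nerve_quotient_def sset_quotient_def orbits_def nerve_sel)
  ultimately have "orbit G ?\<psi> (Chain [Comp K x ya]) = orbit G ?\<psi> (Chain [Comp K x yb])"
    using inj simp by (meson inj_onD)
  moreover have "orbit G ?\<psi> (Chain [m]) = (\<lambda>m. Chain [m]) ` orbit G \<phi>m m" for m
    by (auto simp: orbit_def)
  ultimately show "orbit G \<phi>m (Comp K x ya) = orbit G \<phi>m (Comp K x yb)"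
    by (simp add: inj_image_eq_iff inj_def)
qed

end

theorem proposition3p3:
  fixes G :: "('g, 'x) monoid_scheme" and K Q :: "('o, 'm) cat"
    and \<phi>o :: "'g \<Rightarrow> 'o \<Rightarrow> 'o" and \<phi>m :: "'g \<Rightarrow> 'm \<Rightarrow> 'm"
    and qo :: "'o \<Rightarrow> 'o" and qm :: "'m \<Rightarrow> 'm"
  assumes "category_action G K \<phi>o \<phi>m"
    and "is_quotient G K \<phi>o \<phi>m Q qo qm"
  shows "condition_R G K \<phi>m \<longleftrightarrow>
    (\<forall>t. inj_on (canonical_map qo qm) (skeleton 1 (nerve_quotient G K \<phi>o \<phi>m) t))"
proof -
  interpret category_action G K \<phi>o \<phi>m by fact
  have co: "is_cocone G K \<phi>o \<phi>m Q qo qm" using assms(2) by (simp add: is_quotient_def)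
  have "Simp (nerve_quotient G K \<phi>o \<phi>m) 1 \<subseteq> skeleton 1 (nerve_quotient G K \<phi>o \<phi>m) 1"
    by (auto simp: skeleton_def intro: skeleton_rel.base)
  then show ?thesis
    using inj_on_skeleton_if_condition_R[OF assms(2)] condition_R_if_inj[OF co] inj_on_subset
    by metis
qed

end
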